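(* The logic $\mathbf{IL}\mathsf{P_0M_0}$ does not prove the principle $\mathsf R$; that is, not every instance of the schema $$\mathsf R:\quad (A\rhd B)\rightarrow\bigl(\neg(A\rhd\neg C)\rhd(B\wedge\Box C)\bigr)$$ is a theorem of $\mathbf{IL}\mathsf{P_0M_0}$.
   Context: Modal formulas are built from $\bot$ and countably many propositional variables using $\rightarrow$, the unary modality $\Box$ and the binary modality $\rhd$; other boolean connectives are defined as usual and $\Diamond A:=\neg\Box\neg A$. $\mathbf{IL}$ is the smallest set of formulas containing all propositional tautologies and all instances of the schemata below and closed under Modus Ponens and Necessitation (from $A$ infer $\Box A$): L1: $\Box(A\rightarrow B)\rightarrow(\Box A\rightarrow\Box B)$; L2: $\Box A\rightarrow\Box\Box A$; L3: $\Box(\Box A\rightarrow A)\rightarrow\Box A$; J1: $\Box(A\rightarrow B)\rightarrow (A\rhd B)$; J2: $(A\rhd B)\wedge(B\rhd C)\rightarrow (A\rhd C)$; J3: $(A\rhd C)\wedge(B\rhd C)\rightarrow ((A\vee B)\rhd C)$; J4: $(A\rhd B)\rightarrow(\Diamond A\rightarrow\Diamond B)$; J5: $\Diamond A\rhd A$. $\mathbf{IL}\mathsf{P_0M_0}$ is the logic obtained by adding to $\mathbf{IL}$ (with the same rules) all instances of $\mathsf{P_0}$: $(A\rhd\Diamond B)\rightarrow\Box(A\rhd B)$, and $\mathsf{M_0}$: $(A\rhd B)\rightarrow\bigl((\Diamond A\wedge\Box C)\rhd(B\wedge\Box C)\bigr)$. *)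

theory Defs
  imports Main
begin

datatype form =
    Bot  (\<open>\<^bold>\<bottom>\<close>)
  | Var nat
  | Imp form form  (infixr \<open>\<^bold>\<rightarrow>\<close> 60)
  | Box form  (\<open>\<^bold>\<box> _\<close> [80] 80)
  | Rhd form form  (infix \<open>\<rhd>\<close> 65)

definition Neg :: "form \<Rightarrow> form"  (\<open>\<^bold>\<not> _\<close> [80] 80) where
  "\<^bold>\<not> A = (A \<^bold>\<rightarrow> \<^bold>\<bottom>)"

definition Or :: "form \<Rightarrow> form \<Rightarrow> form"  (infixr \<open>\<^bold>\<or>\<close> 70) where
  "A \<^bold>\<or> B = (\<^bold>\<not> A \<^bold>\<rightarrow> B)"

definition And :: "form \<Rightarrow> form \<Rightarrow> form"  (infixr \<open>\<^bold>\<and>\<close> 75) where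
  "A \<^bold>\<and> B = \<^bold>\<not> (A \<^bold>\<rightarrow> \<^bold>\<not> B)"

definition Dia :: "form \<Rightarrow> form"  (\<open>\<^bold>\<diamond> _\<close> [80] 80) where
  "\<^bold>\<diamond> A = \<^bold>\<not> \<^bold>\<box> \<^bold>\<not> A"

text \<open>A propositional tautology may contain modalities: formulas \<open>\<^bold>\<box> A\<close> and \<open>A \<rhd> B\<close>
  are treated as atoms, and the valuation assigns them arbitrary truth values.\<close>

fun holds :: "(form \<Rightarrow> bool) \<Rightarrow> form \<Rightarrow> bool" where
  "holds v \<^bold>\<bottom> = False"
| "holds v (A \<^bold>\<rightarrow> B) = (holds v A \<longrightarrow> holds v B)"
| "holds v (Var n) = v (Var n)"
| "holds v (\<^bold>\<box> A) = v (\<^bold>\<box> A)"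
| "holds v (A \<rhd> B) = v (A \<rhd> B)"

definition tautology :: "form \<Rightarrow> bool" where
  "tautology A \<longleftrightarrow> (\<forall>v. holds v A)"

text \<open>\<open>ILX X\<close> is IL extended by the formulas in \<open>X\<close> as axioms, under the same rules;
  Necessitation therefore also applies to theorems derived from \<open>X\<close>.\<close>

inductive_set ILX :: "form set \<Rightarrow> form set" for X :: "form set" where
  Taut: "tautology A \<Longrightarrow> A \<in> ILX X"
| L1: "\<^bold>\<box> (A \<^bold>\<rightarrow> B) \<^bold>\<rightarrow> (\<^bold>\<box> A \<^bold>\<rightarrow> \<^bold>\<box> B) \<in> ILX X"
| L2: "\<^bold>\<box> A \<^bold>\<rightarrow> \<^bold>\<box> \<^bold>\<box> A \<in> ILX X"
| L3: "\<^bold>\<box> (\<^bold>\<box> A \<^bold>\<rightarrow> A) \<^bold>\<rightarrow> \<^bold>\<box> A \<in> ILX X"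
| J1: "\<^bold>\<box> (A \<^bold>\<rightarrow> B) \<^bold>\<rightarrow> (A \<rhd> B) \<in> ILX X"
| J2: "((A \<rhd> B) \<^bold>\<and> (B \<rhd> C)) \<^bold>\<rightarrow> (A \<rhd> C) \<in> ILX X"
| J3: "((A \<rhd> C) \<^bold>\<and> (B \<rhd> C)) \<^bold>\<rightarrow> ((A \<^bold>\<or> B) \<rhd> C) \<in> ILX X"
| J4: "(A \<rhd> B) \<^bold>\<rightarrow> (\<^bold>\<diamond> A \<^bold>\<rightarrow> \<^bold>\<diamond> B) \<in> ILX X"
| J5: "\<^bold>\<diamond> A \<rhd> A \<in> ILX X"
| Ext: "A \<in> X \<Longrightarrow> A \<in> ILX X"
| MP: "A \<^bold>\<rightarrow> B \<in> ILX X \<Longrightarrow> A \<in> ILX X \<Longrightarrow> B \<in> ILX X"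
| Nec: "A \<in> ILX X \<Longrightarrow> \<^bold>\<box> A \<in> ILX X"

definition P0_schema :: "form set" where
  "P0_schema = {(A \<rhd> \<^bold>\<diamond> B) \<^bold>\<rightarrow> \<^bold>\<box> (A \<rhd> B) | A B. True}"

definition M0_schema :: "form set" where
  "M0_schema = {(A \<rhd> B) \<^bold>\<rightarrow> ((\<^bold>\<diamond> A \<^bold>\<and> \<^bold>\<box> C) \<rhd> (B \<^bold>\<and> \<^bold>\<box> C)) | A B C. True}"

definition ILP0M0 :: "form set" where
  "ILP0M0 = ILX (P0_schema \<union> M0_schema)"

definition R_inst :: "form \<Rightarrow> form \<Rightarrow> form \<Rightarrow> form" where
  "R_inst A B C = (A \<rhd> B) \<^bold>\<rightarrow> (\<^bold>\<not> (A \<rhd> \<^bold>\<not> C) \<rhd> (B \<^bold>\<and> \<^bold>\<box> C))"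

end

theory Submission
  imports Defs
begin

text \<open>Generalized Veltman semantics, in which \<open>S\<^sub>w\<close> relates a world to sets of worlds, refutes
  the principle \<open>R\<close>. If \<open>w R x R u\<close> and \<open>u S\<^sub>w V\<close> with \<open>V = {v\<^sub>1, v\<^sub>2}\<close>, then \<open>P\<^sub>0\<close> makes \<open>u\<close> see under \<open>S\<^sub>x\<close> every
  set that contains a successor of each \<open>v\<^sub>i\<close>. A set \<open>C\<close> meeting all of these has to contain all
  successors of one \<open>v\<^sub>i\<close>, but principle \<open>R\<close> asks for \<open>x S\<^sub>w {v\<^sub>i}\<close>, whereas \<open>M\<^sub>0\<close> is already satisfied by
  \<open>x S\<^sub>w {v\<^sub>1, v\<^sub>2}\<close>.\<close>

text \<open>\<open>S_refl\<close> and \<open>S_trans\<close> together make \<open>S w u\<close> closed under supersets, and \<open>S_trans\<close> also makes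
  it depend on the \<open>R\<close>-successors of \<open>w\<close> only.\<close>

locale gen_veltman_frame =
  fixes R :: "'w \<Rightarrow> 'w \<Rightarrow> bool"
    and S :: "'w \<Rightarrow> 'w \<Rightarrow> 'w set \<Rightarrow> bool"
  assumes R_trans: "R w x \<Longrightarrow> R x y \<Longrightarrow> R w y"
    and R_conv_wf: "wf {(y, x). R x y}"
    and S_refl: "R w u \<Longrightarrow> u \<in> V \<Longrightarrow> S w u V"
    and S_R: "R w u \<Longrightarrow> R u v \<Longrightarrow> v \<in> V \<Longrightarrow> S w u V"
    and S_nonempty: "R w u \<Longrightarrow> \<not> S w u {}"
    and S_trans: "R w u \<Longrightarrow> S w u V \<Longrightarrow> (\<And>v. v \<in> V \<Longrightarrow> R w v \<Longrightarrow> S w v Z) \<Longrightarrow> S w u Z"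
begin

lemma S_mono:
  assumes "R w u" "S w u V" "\<And>v. v \<in> V \<Longrightarrow> R w v \<Longrightarrow> v \<in> Z"
  shows "S w u Z"
  using assms(1,2) by (rule S_trans) (simp add: S_refl assms(3))

primrec sat :: "(nat \<Rightarrow> 'w set) \<Rightarrow> form \<Rightarrow> 'w set" where
  "sat v \<^bold>\<bottom> = {}"
| "sat v (Var n) = v n"
| "sat v (A \<^bold>\<rightarrow> B) = - sat v A \<union> sat v B"
| "sat v (\<^bold>\<box> A) = {w. \<forall>u. R w u \<longrightarrow> u \<in> sat v A}"
| "sat v (A \<rhd> B) = {w. \<forall>u. R w u \<longrightarrow> u \<in> sat v A \<longrightarrow> S w u (sat v B)}"

lemma sat_connectives [simp]:
  "sat v (\<^bold>\<not> A) = - sat v A"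
  "sat v (A \<^bold>\<or> B) = sat v A \<union> sat v B"
  "sat v (A \<^bold>\<and> B) = sat v A \<inter> sat v B"
  "sat v (\<^bold>\<diamond> A) = {w. \<exists>u. R w u \<and> u \<in> sat v A}"
  by (auto simp: Neg_def Or_def And_def Dia_def)

text \<open>Each world induces a valuation of the modal atoms; this yields soundness for
  tautologies.\<close>

lemma holds_iff_sat: "holds (\<lambda>B. w \<in> sat v B) A \<longleftrightarrow> w \<in> sat v A"
  by (induction A) auto

lemma sat_Loeb:
  assumes hyp: "w \<in> sat v (\<^bold>\<box> (\<^bold>\<box> A \<^bold>\<rightarrow> A))"
  shows "w \<in> sat v (\<^bold>\<box> A)"
proof -
  have "R w u \<longrightarrow> u \<in> sat v A" for u
    using R_conv_wf
  proof (induction u)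
    case (less u)
    show ?case
    proof
      assume "R w u"
      with hyp have "u \<in> sat v (\<^bold>\<box> A \<^bold>\<rightarrow> A)"
        by simp
      moreover have "u \<in> sat v (\<^bold>\<box> A)"
        using less R_trans[OF \<open>R w u\<close>] by simp
      ultimately show "u \<in> sat v A"
        by auto
    qed
  qed
  then show ?thesis
    by simp
qed

theorem IL_sound:
  assumes "A \<in> ILX X" and X_valid: "\<And>B w. B \<in> X \<Longrightarrow> w \<in> sat v B"
  shows "w \<in> sat v A"
  using assms(1)
proof (induction arbitrary: w)
  case (Taut A)
  then show ?case
    using holds_iff_sat[of w v A] by (simp add: tautology_def)
next
  case (L2 A)
  then show ?case
    using R_trans by auto
next
  case (L3 A)
  then show ?case
    using sat_Loeb[of w v A] unfolding sat.simps(3) by blast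
next
  case (J1 A B)
  then show ?case
    using S_refl by auto
next
  case (J2 A B C)
  have "S w u (sat v C)"
    if "R w u" "S w u (sat v B)" "w \<in> sat v (B \<rhd> C)" for u
    using that(1,2) by (rule S_trans) (use that(3) in auto)
  then show ?case
    by auto
next
  case (J4 A B)
  \<comment> \<open>Otherwise \<open>S_mono\<close> would shrink the target set to the empty
    set.\<close>
  have "\<exists>z. R w z \<and> z \<in> sat v B" if "R w u" "S w u (sat v B)" for u
    using S_mono[OF that, of "{}"] S_nonempty[OF that(1)] by auto
  then show ?case
    by auto
next
  case (J5 A)
  then show ?case
    using S_R by auto
next
  case (Ext A)
  then show ?case
    by (rule X_valid)
qed auto

lemma P0_valid:
  assumes frame: "\<And>w x u Z. R w x \<Longrightarrow> R x u \<Longrightarrow> S w u {v. \<exists>z\<in>Z. R v z} \<Longrightarrow> S x u Z"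
    and "D \<in> P0_schema"
  shows "w \<in> sat v D"
proof -
  obtain A B where D: "D = (A \<rhd> \<^bold>\<diamond> B) \<^bold>\<rightarrow> \<^bold>\<box> (A \<rhd> B)"
    using assms(2) by (auto simp: P0_schema_def)
  have "S x u (sat v B)"
    if "w \<in> sat v (A \<rhd> \<^bold>\<diamond> B)" "R w x" "R x u" "u \<in> sat v A" for x u
  proof (rule frame[OF that(2,3)])
    have "S w u (sat v (\<^bold>\<diamond> B))"
      using that R_trans by simp
    then show "S w u {v'. \<exists>z\<in>sat v B. R v' z}"
      by (simp add: Bex_def conj_commute)
  qed
  then show ?thesis
    by (auto simp: D)
qed

lemma M0_valid:
  assumes frame: "\<And>w x u V. R w x \<Longrightarrow> R x u \<Longrightarrow> S w u V
      \<Longrightarrow> S w x {v \<in> V. \<forall>z. R v z \<longrightarrow> R x z}"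
    and "D \<in> M0_schema"
  shows "w \<in> sat v D"
proof -
  obtain A B C where D: "D = (A \<rhd> B) \<^bold>\<rightarrow> ((\<^bold>\<diamond> A \<^bold>\<and> \<^bold>\<box> C) \<rhd> (B \<^bold>\<and> \<^bold>\<box> C))"
    using assms(2) by (auto simp: M0_schema_def)
  have "S w x (sat v (B \<^bold>\<and> \<^bold>\<box> C))"
    if "w \<in> sat v (A \<rhd> B)" "R w x" "R x u" "u \<in> sat v A" "x \<in> sat v (\<^bold>\<box> C)" for x u
  proof -
    have "S w u (sat v B)"
      using that(1,4) R_trans[OF that(2,3)] by simp
    from that(2) frame[OF that(2,3) this] show ?thesis
      by (rule S_mono) (use that(5) in auto)
  qed
  then show ?thesis
    by (auto simp: D)
qed

end

datatype world = W | X | U | V1 | V2 | Z1 | Z2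

text \<open>Makes conditions on arbitrary sets of worlds propositional in seven membership
  atoms.\<close>

lemma all_world:
  "(\<forall>w. P w) \<longleftrightarrow> P W \<and> P X \<and> P U \<and> P V1 \<and> P V2 \<and> P Z1 \<and> P Z2"
  using world.induct[of P] by blast

fun succs :: "world \<Rightarrow> world set" where
  "succs W = {X, U, V1, V2, Z1, Z2}"
| "succs X = {U, Z1, Z2}"
| "succs V1 = {Z1}"
| "succs V2 = {Z2}"
| "succs _ = {}"

abbreviation acc :: "world \<Rightarrow> world \<Rightarrow> bool" where
  "acc w u \<equiv> u \<in> succs w"

text \<open>On accessible pairs, this is the closure under the frame axioms of two generators:
  \<open>U\<close> to \<open>{V1, V2}\<close> under \<open>W\<close>, and \<open>U\<close> to
  \<open>{Z1, Z2}\<close> under \<open>X\<close>.\<close>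

fun reach :: "world \<Rightarrow> world \<Rightarrow> world set \<Rightarrow> bool" where
  "reach W X V \<longleftrightarrow> X \<in> V \<or> U \<in> V \<or> Z1 \<in> V \<or> Z2 \<in> V \<or> (V1 \<in> V \<and> V2 \<in> V)"
| "reach W U V \<longleftrightarrow> U \<in> V \<or> ((V1 \<in> V \<or> Z1 \<in> V) \<and> (V2 \<in> V \<or> Z2 \<in> V))"
| "reach W V1 V \<longleftrightarrow> V1 \<in> V \<or> Z1 \<in> V"
| "reach W V2 V \<longleftrightarrow> V2 \<in> V \<or> Z2 \<in> V"
| "reach X U V \<longleftrightarrow> U \<in> V \<or> (Z1 \<in> V \<and> Z2 \<in> V)"
| "reach _ u V \<longleftrightarrow> u \<in> V"

interpretation countermodel: gen_veltman_frame acc reach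
proof
  show "acc w y" if "acc w x" "acc x y" for w x y
    using that by (cases w; cases x) auto
  have "card (succs u) < card (succs w)" if "acc w u" for w u
    using that by (cases w; cases u) simp_all
  then have "{(y, x). acc x y} \<subseteq> measure (\<lambda>w. card (succs w))"
    by auto
  then show "wf {(y, x). acc x y}"
    by (rule wf_subset[OF wf_measure])
  show "reach w u V" if "acc w u" "u \<in> V" for w u V
    using that by (cases w; cases u) simp_all
  show "reach w u V" if "acc w u" "acc u v" "v \<in> V" for w u v V
    using that by (cases w; cases u) auto
  show "\<not> reach w u {}" if "acc w u" for w u
    using that by (cases w; cases u) simp_all
  show "reach w u Z"
    if "acc w u" "reach w u V" and *: "\<And>v. v \<in> V \<Longrightarrow> acc w v \<Longrightarrow> reach w v Z" for w u V Z
  proof -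
    have "\<forall>v. v \<in> V \<longrightarrow> acc w v \<longrightarrow> reach w v Z"
      using * by blast
    then show ?thesis
      using that(1,2) unfolding all_world by (cases w; cases u) (simp_all, blast+)
  qed
qed

text \<open>The premises force the chain \<open>W\<close>, \<open>X\<close>, \<open>U\<close>, since
  \<open>Z1\<close> and \<open>Z2\<close> are dead ends. As \<open>U\<close> is one too,
  \<open>V1\<close> and \<open>V2\<close> must both see \<open>Z\<close>, so \<open>Z\<close>
  contains \<open>Z1\<close> and \<open>Z2\<close>.\<close>

lemma countermodel_P0:
  assumes "acc w x" "acc x u" "reach w u {v. \<exists>z\<in>Z. acc v z}"
  shows "reach x u Z"
  using assms by (cases w; cases x; cases u) simp_all

text \<open>For \<open>x = X\<close> the filter discards at most \<open>W\<close>, as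
  \<open>X\<close> sees all successors of \<open>V1\<close> and \<open>V2\<close>.\<close>

lemma countermodel_M0:
  assumes "acc w x" "acc x u" "reach w u V"
  shows "reach w x {v \<in> V. \<forall>z. acc v z \<longrightarrow> acc x z}"
  using assms unfolding all_world by (cases w; cases x; cases u) (simp_all, blast)

lemma ILP0M0_sound:
  assumes "A \<in> ILP0M0"
  shows "w \<in> countermodel.sat v A"
  using assms unfolding ILP0M0_def
proof (rule countermodel.IL_sound)
  fix B w
  assume "B \<in> P0_schema \<union> M0_schema"
  then show "w \<in> countermodel.sat v B"
  proof
    assume "B \<in> P0_schema"
    with countermodel_P0 show ?thesis
      by (rule countermodel.P0_valid)
  next
    assume "B \<in> M0_schema"
    with countermodel_M0 show ?thesis
      by (rule countermodel.M0_valid)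
  qed
qed

theorem theorem3p15:
  shows "\<not> (\<forall>A B C. R_inst A B C \<in> ILP0M0)"
proof
  assume "\<forall>A B C. R_inst A B C \<in> ILP0M0"
  \<comment> \<open>\<open>U\<close> and \<open>Z1\<close> in the third set make \<open>X\<close>
    satisfy the negated formula. Only \<open>V1\<close> satisfies the right-hand side, and
    \<open>X\<close> does not reach \<open>{V1}\<close> under \<open>W\<close>.\<close>
  then have "W \<in> countermodel.sat (\<lambda>n. [{U}, {V1, V2}, {U, Z1}] ! n)
      (R_inst (Var 0) (Var 1) (Var 2))"
    using ILP0M0_sound by blast
  then show False
    by (auto simp: R_inst_def all_world)
qed

end
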